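(* For $\alpha\in\mathbb R$ let $\Phi^2_\alpha:\mathcal M_3\to\mathcal M_3$ be the linear map $$\Phi^2_\alpha(X)=X+\sum_{i=2}^{9}\gamma_i\Big(G_iXG_i-\tfrac12(G_iG_iX+XG_iG_i)\Big),$$ with $\gamma_2=\gamma_3=\dots=\gamma_8=\alpha$ and $\gamma_9=\alpha/3$. Then: (i) for $\alpha=\tfrac14$ and $\rho=(\rho_{jk})\in\mathcal M_3$, $$\Phi^2_{1/4}(\rho)=\begin{bmatrix}\frac{\rho_{22}+\rho_{33}}2&-\frac{\rho_{12}}2&-\frac{\rho_{13}}2\\-\frac{\rho_{21}}2&\frac{\rho_{11}+\rho_{33}}2&-\frac{\rho_{23}}2\\-\frac{\rho_{31}}2&-\frac{\rho_{32}}2&\frac{\rho_{11}+\rho_{22}}2\end{bmatrix};$$ (ii) $\Phi^2_\alpha$ is positive for $0\le\alpha\le\tfrac14$; (iii) $\Phi^2_\alpha$ is not completely positive for $\alpha>\tfrac3{16}$, hence it is positive but not completely positive for $\tfrac3{16}<\alpha\le\tfrac14$; (iv) $\Phi^2_\alpha$ is decomposable for $0\le\alpha\le\tfrac14$.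
   Context: $\mathcal M_3$ is the algebra of $3\times3$ complex matrices with matrix units $E_{jk}$. The Gell-Mann matrices are numbered and normalized as follows: $G_2=E_{12}+E_{21}$, $G_3=-iE_{12}+iE_{21}$, $G_4=\mathrm{diag}(1,-1,0)$, $G_5=E_{13}+E_{31}$, $G_6=-iE_{13}+iE_{31}$, $G_7=E_{23}+E_{32}$, $G_8=-iE_{23}+iE_{32}$, $G_9=\mathrm{diag}(1,1,-2)$. A linear map on $\mathcal M_3$ is positive if it preserves positive semidefiniteness, completely positive if all its amplifications $\mathrm{id}_n\otimes\Phi$ are positive, completely co-positive if it is the composition of transposition with a completely positive map, and decomposable if it is the sum of a completely positive map and a completely co-positive map. *)

theory Defs
  imports "HOL-Analysis.Analysis"
begin

text \<open>Indices of type \<^typ>\<open>3\<close> are written 1, 2, 3; in that type 3 = 0, and 1, 2, 3 are distinct.\<close>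

type_synonym mat3 = "complex^3^3"

definition mat_unit :: "3 \<Rightarrow> 3 \<Rightarrow> mat3" where
  "mat_unit j k = axis j (axis k 1)"

definition cscale :: "complex \<Rightarrow> mat3 \<Rightarrow> mat3" where
  "cscale c A = (\<chi> j k. c * A $ j $ k)"

lemma vector_space_cscale: "vector_space cscale"
  by unfold_locales (simp_all add: cscale_def vec_eq_iff algebra_simps)

abbreviation complex_linear :: "(mat3 \<Rightarrow> mat3) \<Rightarrow> bool" where
  "complex_linear \<equiv> Vector_Spaces.linear cscale cscale"

text \<open>Positive semidefiniteness of a complex matrix with rows and columns indexed by a finite
  set \<open>I\<close>. Since all complex vectors are tested, this forces the matrix to be Hermitian on \<open>I\<close>.\<close>

definition psd_on :: "'i set \<Rightarrow> ('i \<Rightarrow> 'i \<Rightarrow> complex) \<Rightarrow> bool" where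
  "psd_on I A \<longleftrightarrow>
     (\<forall>v. (\<Sum>p\<in>I. \<Sum>q\<in>I. cnj (v p) * A p q * v q) \<in> \<real>\<^sub>\<ge>\<^sub>0)"

abbreviation psd3 :: "mat3 \<Rightarrow> bool" where
  "psd3 A \<equiv> psd_on UNIV (\<lambda>j k. A $ j $ k)"

definition positive_map :: "(mat3 \<Rightarrow> mat3) \<Rightarrow> bool" where
  "positive_map \<Phi> \<longleftrightarrow> complex_linear \<Phi> \<and> (\<forall>A. psd3 A \<longrightarrow> psd3 (\<Phi> A))"

text \<open>Elements of the tensor product of the \<open>n\<close> by \<open>n\<close> matrices with the 3 by 3 matrices are
  matrices with index set \<open>{..<n} \<times> UNIV\<close>. The map \<open>id\<^sub>n \<otimes> \<Phi>\<close> sends the tensor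
  \<open>E\<^sub>i\<^sub>j \<otimes> X\<close> to \<open>E\<^sub>i\<^sub>j \<otimes> \<Phi> X\<close>, that is, it applies \<open>\<Phi>\<close> to every 3 by 3 block; so the same
  formula serves for all \<open>n\<close>, which enters only through the index set.\<close>

definition amplification ::
  "(mat3 \<Rightarrow> mat3) \<Rightarrow> (nat \<times> 3 \<Rightarrow> nat \<times> 3 \<Rightarrow> complex) \<Rightarrow> (nat \<times> 3 \<Rightarrow> nat \<times> 3 \<Rightarrow> complex)" where
  "amplification \<Phi> A = (\<lambda>(i, a) (j, b). \<Phi> (\<chi> c d. A (i, c) (j, d)) $ a $ b)"

definition completely_positive :: "(mat3 \<Rightarrow> mat3) \<Rightarrow> bool" where
  "completely_positive \<Phi> \<longleftrightarrow> complex_linear \<Phi> \<and>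
     (\<forall>n A. psd_on ({..<n} \<times> UNIV) A \<longrightarrow> psd_on ({..<n} \<times> UNIV) (amplification \<Phi> A))"

definition completely_copositive :: "(mat3 \<Rightarrow> mat3) \<Rightarrow> bool" where
  "completely_copositive \<Phi> \<longleftrightarrow> (\<exists>\<Psi>. completely_positive \<Psi> \<and> \<Phi> = \<Psi> \<circ> transpose)"

definition decomposable :: "(mat3 \<Rightarrow> mat3) \<Rightarrow> bool" where
  "decomposable \<Phi> \<longleftrightarrow>
     (\<exists>\<Phi>\<^sub>1 \<Phi>\<^sub>2. completely_positive \<Phi>\<^sub>1 \<and> completely_copositive \<Phi>\<^sub>2 \<and>
        \<Phi> = (\<lambda>X. \<Phi>\<^sub>1 X + \<Phi>\<^sub>2 X))"

text \<open>Only the indices 2 to 9 are meaningful.\<close>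

definition gell_mann :: "nat \<Rightarrow> mat3" where
  "gell_mann i =
    (if i = 2 then mat_unit 1 2 + mat_unit 2 1
     else if i = 3 then cscale (- \<i>) (mat_unit 1 2) + cscale \<i> (mat_unit 2 1)
     else if i = 4 then mat_unit 1 1 - mat_unit 2 2
     else if i = 5 then mat_unit 1 3 + mat_unit 3 1
     else if i = 6 then cscale (- \<i>) (mat_unit 1 3) + cscale \<i> (mat_unit 3 1)
     else if i = 7 then mat_unit 2 3 + mat_unit 3 2
     else if i = 8 then cscale (- \<i>) (mat_unit 2 3) + cscale \<i> (mat_unit 3 2)
     else if i = 9 then mat_unit 1 1 + mat_unit 2 2 - cscale 2 (mat_unit 3 3)
     else 0)"

definition gamma_coeff :: "real \<Rightarrow> nat \<Rightarrow> real" where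
  "gamma_coeff \<alpha> i = (if i = 9 then \<alpha> / 3 else \<alpha>)"

definition Phi2 :: "real \<Rightarrow> mat3 \<Rightarrow> mat3" where
  "Phi2 \<alpha> X = X + (\<Sum>i = 2..9. gamma_coeff \<alpha> i *\<^sub>R
     (gell_mann i ** X ** gell_mann i
      - (1 / 2) *\<^sub>R (gell_mann i ** gell_mann i ** X + X ** gell_mann i ** gell_mann i)))"

end

theory Submission
  imports Defs
begin

text \<open>Since \<open>\<Sum>\<^sub>i \<gamma>\<^sub>i G\<^sub>i X G\<^sub>i = \<alpha> (2 tr X - 2/3 X)\<close> and \<open>\<Sum>\<^sub>i \<gamma>\<^sub>i G\<^sub>i\<^sup>2 = 16/3 \<alpha>\<close>,
  the map is \<open>(1 - 6\<alpha>) X + 2\<alpha> tr X = (1 - 4\<alpha>) X + 2\<alpha> (tr X - X)\<close>. The reduction map \<open>tr X - X\<close> is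
  completely co-positive, because \<open>tr X - X\<^sup>T\<close> is the sum of the maps \<open>K X K\<^sup>*\<close> over the three
  antisymmetric matrices \<open>K = E\<^sub>j\<^sub>k - E\<^sub>k\<^sub>j\<close>; this gives decomposability and positivity. The Choi
  matrix has expectation \<open>9 - 48\<alpha>\<close> in the unnormalized maximally entangled vector, which is
  negative for \<open>\<alpha> > 3/16\<close>.\<close>

lemma complex_linear_iff:
  "complex_linear \<Phi> \<longleftrightarrow>
    (\<forall>X Y. \<Phi> (X + Y) = \<Phi> X + \<Phi> Y) \<and> (\<forall>c X. \<Phi> (cscale c X) = cscale c (\<Phi> X))"
  by (simp add: Vector_Spaces.linear_iff vector_space_cscale)

lemma cscale_nth [simp]: "cscale c A $ j $ k = c * A $ j $ k"
  by (simp add: cscale_def)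

lemma mat_unit_nth: "mat_unit j k $ a $ b = (if a = j \<and> b = k then 1 else 0)"
  by (simp add: mat_unit_def axis_def)

text \<open>The weight \<open>\<alpha> / 3\<close> compensates for tr(G_9^2) = 6 against 2 for the
  others. The sum thus treats the eight matrices as an equally normalized orthogonal basis of the
  traceless matrices, so only X and tr X survive.\<close>

lemma Phi2_eq:
  "Phi2 \<alpha> X = cscale (1 - 6 * of_real \<alpha>) X + cscale (2 * of_real \<alpha> * trace X) (mat 1)"
proof -
  have "{2..9} = {2, 3, 4, 5, 6, 7, 8, 9::nat}" by auto
  then show ?thesis
    unfolding Phi2_def
    by (simp add: vec_eq_iff forall_3 matrix_matrix_mult_def sum_3 gell_mann_def
        gamma_coeff_def mat_unit_nth trace_def mat_def scaleR_conv_of_real[where 'a=complex])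
      (simp add: field_simps)
qed

lemma complex_linear_Phi2: "complex_linear (Phi2 \<alpha>)"
  by (simp add: complex_linear_iff Phi2_eq vec_eq_iff trace_def sum.distrib sum_distrib_left
      algebra_simps)

lemma Phi2_quarter:
  "Phi2 (1 / 4) \<rho> = vector
      [vector [(\<rho> $ 2 $ 2 + \<rho> $ 3 $ 3) / 2, - (\<rho> $ 1 $ 2) / 2, - (\<rho> $ 1 $ 3) / 2],
       vector [- (\<rho> $ 2 $ 1) / 2, (\<rho> $ 1 $ 1 + \<rho> $ 3 $ 3) / 2, - (\<rho> $ 2 $ 3) / 2],
       vector [- (\<rho> $ 3 $ 1) / 2, - (\<rho> $ 3 $ 2) / 2, (\<rho> $ 1 $ 1 + \<rho> $ 2 $ 2) / 2]]"
  by (simp add: Phi2_eq vec_eq_iff forall_3 trace_def sum_3 mat_def field_simps)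

lemma psd_on_add: "psd_on I A \<Longrightarrow> psd_on I B \<Longrightarrow> psd_on I (\<lambda>p q. A p q + B p q)"
  by (auto simp: psd_on_def algebra_simps sum.distrib intro!: nonneg_Reals_add_I)

lemma psd_on_scale:
  assumes "0 \<le> c" "psd_on I A"
  shows "psd_on I (\<lambda>p q. of_real c * A p q)"
proof -
  have "(\<Sum>p\<in>I. \<Sum>q\<in>I. cnj (v p) * (of_real c * A p q) * v q)
      = of_real c * (\<Sum>p\<in>I. \<Sum>q\<in>I. cnj (v p) * A p q * v q)" for v
    by (simp add: sum_distrib_left algebra_simps)
  with assms show ?thesis
    by (auto simp: psd_on_def intro!: nonneg_Reals_mult_I)
qed

text \<open>The quadratic form of the transpose at \<open>v\<close> is that of \<open>A\<close> at
  the entrywise conjugate of \<open>v\<close>.\<close>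

lemma psd_on_transpose:
  assumes "psd_on I A"
  shows "psd_on I (\<lambda>p q. A q p)"
  unfolding psd_on_def
proof
  fix v
  have "(\<Sum>p\<in>I. \<Sum>q\<in>I. cnj (v p) * A q p * v q)
      = (\<Sum>p\<in>I. \<Sum>q\<in>I. cnj (cnj (v p)) * A p q * cnj (v q))"
    by (subst sum.swap) (simp add: mult_ac)
  also have "\<dots> \<in> \<real>\<^sub>\<ge>\<^sub>0"
    using assms unfolding psd_on_def by (rule spec)
  finally show "(\<Sum>p\<in>I. \<Sum>q\<in>I. cnj (v p) * A q p * v q) \<in> \<real>\<^sub>\<ge>\<^sub>0" .
qed

text \<open>The map with the single Kraus operator \<open>K\<close>; the last factor is the adjoint
  of \<open>K\<close>.\<close>

definition conjugation :: "mat3 \<Rightarrow> mat3 \<Rightarrow> mat3" where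
  "conjugation K X = K ** X ** (\<chi> a b. cnj (K $ b $ a))"

lemma conjugation_nth:
  "conjugation K X $ a $ b = (\<Sum>c\<in>UNIV. \<Sum>d\<in>UNIV. K $ a $ c * X $ c $ d * cnj (K $ b $ d))"
  unfolding conjugation_def matrix_matrix_mult_def
  by (simp add: sum_distrib_right) (rule sum.swap)

text \<open>The adjoint of \<open>K\<close> moves onto both vectors. They are kept independent
  because the block (i, j) of an amplification pairs the i-th and j-th components of a test
  vector.\<close>

lemma conjugation_form:
  "(\<Sum>a\<in>UNIV. \<Sum>b\<in>UNIV. cnj (x a) * conjugation K X $ a $ b * y b)
    = (\<Sum>c\<in>UNIV. \<Sum>d\<in>UNIV. cnj (\<Sum>a\<in>UNIV. cnj (K $ a $ c) * x a) * X $ c $ d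
        * (\<Sum>b\<in>UNIV. cnj (K $ b $ d) * y b))"
  by (simp add: conjugation_nth sum_3 algebra_simps)

lemma completely_positive_conjugation: "completely_positive (conjugation K)"
  unfolding completely_positive_def
proof (intro conjI allI impI)
  show "complex_linear (conjugation K)"
    by (simp add: complex_linear_iff vec_eq_iff conjugation_nth sum_distrib_left sum.distrib
        algebra_simps)
next
  fix n :: nat and A :: "nat \<times> 3 \<Rightarrow> nat \<times> 3 \<Rightarrow> complex"
  assume A: "psd_on ({..<n} \<times> UNIV) A"
  show "psd_on ({..<n} \<times> UNIV) (amplification (conjugation K) A)"
    unfolding psd_on_def
  proof
    fix v :: "nat \<times> 3 \<Rightarrow> complex"
    \<comment> \<open>Apply the adjoint of \<open>K\<close> to each component of \<open>v\<close>:
      testing the amplified matrix on \<open>v\<close> then amounts to testing \<open>A\<close> on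
      \<open>w\<close>.\<close>
    define w where "w = (\<lambda>(i, c). \<Sum>a\<in>UNIV. cnj (K $ a $ c) * v (i, a))"
    \<comment> \<open>Bring the block indices outside, so that \<open>conjugation_form\<close>
      applies to each block separately.\<close>
    have "(\<Sum>p\<in>{..<n} \<times> UNIV. \<Sum>q\<in>{..<n} \<times> UNIV.
            cnj (v p) * amplification (conjugation K) A p q * v q)
        = (\<Sum>i<n. \<Sum>j<n. \<Sum>a\<in>UNIV. \<Sum>b\<in>UNIV.
            cnj (v (i, a)) * conjugation K (\<chi> c d. A (i, c) (j, d)) $ a $ b * v (j, b))"
      by (simp add: sum.cartesian_product' amplification_def sum.swap[of _ "{..<n}" UNIV])
    also have "\<dots> = (\<Sum>i<n. \<Sum>j<n. \<Sum>c\<in>UNIV. \<Sum>d\<in>UNIV.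
            cnj (w (i, c)) * A (i, c) (j, d) * w (j, d))"
      by (simp add: conjugation_form w_def)
    also have "\<dots> = (\<Sum>p\<in>{..<n} \<times> UNIV. \<Sum>q\<in>{..<n} \<times> UNIV. cnj (w p) * A p q * w q)"
      by (simp add: sum.cartesian_product' sum.swap[of _ "{..<n}" UNIV])
    also have "\<dots> \<in> \<real>\<^sub>\<ge>\<^sub>0"
      using A unfolding psd_on_def by (rule spec)
    finally show "(\<Sum>p\<in>{..<n} \<times> UNIV. \<Sum>q\<in>{..<n} \<times> UNIV.
        cnj (v p) * amplification (conjugation K) A p q * v q) \<in> \<real>\<^sub>\<ge>\<^sub>0" .
  qed
qed

lemma completely_positive_add:
  assumes "completely_positive \<Phi>" "completely_positive \<Psi>"
  shows "completely_positive (\<lambda>X. \<Phi> X + \<Psi> X)"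
proof -
  have "amplification (\<lambda>X. \<Phi> X + \<Psi> X) A
      = (\<lambda>p q. amplification \<Phi> A p q + amplification \<Psi> A p q)" for A
    by (auto simp: amplification_def fun_eq_iff)
  with assms show ?thesis
    by (auto simp: completely_positive_def complex_linear_iff vec_eq_iff algebra_simps
        intro!: psd_on_add)
qed

lemma completely_positive_scale:
  assumes "0 \<le> c" "completely_positive \<Phi>"
  shows "completely_positive (\<lambda>X. cscale (of_real c) (\<Phi> X))"
proof -
  have "amplification (\<lambda>X. cscale (of_real c) (\<Phi> X)) A
      = (\<lambda>p q. of_real c * amplification \<Phi> A p q)" for A
    by (auto simp: amplification_def fun_eq_iff)
  with assms show ?thesis
    by (auto simp: completely_positive_def complex_linear_iff vec_eq_iff algebra_simps
        intro!: psd_on_scale)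
qed

lemma completely_positive_id: "completely_positive (\<lambda>X. X)"
proof -
  have "amplification (\<lambda>X. X) A = A" for A
    by (auto simp: amplification_def fun_eq_iff)
  then show ?thesis
    by (simp add: completely_positive_def complex_linear_iff)
qed

lemma completely_positive_imp_positive:
  assumes "completely_positive \<Phi>"
  shows "positive_map \<Phi>"
  unfolding positive_map_def
proof (intro conjI allI impI)
  show "complex_linear \<Phi>"
    using assms by (simp add: completely_positive_def)
next
  fix A :: mat3
  assume A: "psd3 A"
  \<comment> \<open>Positivity is the case n = 1: \<open>A\<close> becomes the only block, its block
    index being ignored.\<close>
  let ?A = "\<lambda>p q :: nat \<times> 3. A $ snd p $ snd q"
  have single: "{..<1::nat} = {0}" by auto
  have "psd_on ({..<1} \<times> UNIV) ?A"
    unfolding psd_on_def single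
  proof
    fix v :: "nat \<times> 3 \<Rightarrow> complex"
    show "(\<Sum>p\<in>{0} \<times> UNIV. \<Sum>q\<in>{0} \<times> UNIV. cnj (v p) * ?A p q * v q) \<in> \<real>\<^sub>\<ge>\<^sub>0"
      using A[unfolded psd_on_def, rule_format, of "\<lambda>a. v (0, a)"]
      by (simp add: sum.cartesian_product')
  qed
  then have amp: "psd_on ({..<1} \<times> UNIV) (amplification \<Phi> ?A)"
    using assms unfolding completely_positive_def by blast
  show "psd3 (\<Phi> A)"
    unfolding psd_on_def
  proof
    fix v :: "3 \<Rightarrow> complex"
    show "(\<Sum>p\<in>UNIV. \<Sum>q\<in>UNIV. cnj (v p) * \<Phi> A $ p $ q * v q) \<in> \<real>\<^sub>\<ge>\<^sub>0"
      using amp[unfolded psd_on_def single, rule_format, of "\<lambda>p. v (snd p)"]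
      by (simp add: sum.cartesian_product' amplification_def)
  qed
qed

lemma completely_copositive_imp_positive:
  assumes "completely_copositive \<Phi>"
  shows "positive_map \<Phi>"
proof -
  obtain \<Psi> where \<Psi>: "positive_map \<Psi>" "\<Phi> = \<Psi> \<circ> transpose"
    using assms completely_positive_imp_positive by (auto simp: completely_copositive_def)
  have add: "transpose (X + Y) = transpose X + transpose Y" for X Y :: mat3
    by (simp add: transpose_def vec_eq_iff)
  have scale: "transpose (cscale c X) = cscale c (transpose X)" for c X
    by (simp add: transpose_def vec_eq_iff)
  have "psd3 (transpose X)" if "psd3 X" for X
    using psd_on_transpose[OF that] by (simp add: transpose_def)
  then show ?thesis
    using \<Psi> by (simp add: positive_map_def complex_linear_iff add scale)
qed

lemma decomposable_imp_positive:
  assumes "decomposable \<Phi>"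
  shows "positive_map \<Phi>"
proof -
  obtain \<Phi>\<^sub>1 \<Phi>\<^sub>2 where "positive_map \<Phi>\<^sub>1" "positive_map \<Phi>\<^sub>2" "\<Phi> = (\<lambda>X. \<Phi>\<^sub>1 X + \<Phi>\<^sub>2 X)"
    using assms completely_positive_imp_positive completely_copositive_imp_positive
    unfolding decomposable_def by blast
  then show ?thesis
    by (auto simp: positive_map_def complex_linear_iff vec_eq_iff algebra_simps
        intro!: psd_on_add)
qed

text \<open>Conjugation by E_jk - E_kj puts X_kk at (j, j), X_jj at (k, k), -X_kj at (j, k) and
  -X_jk at (k, j). Summing over the three pairs leaves tr X - X_jj on the diagonal.\<close>

lemma trace_minus_transpose_eq:
  "cscale (trace X) (mat 1) - transpose X =
    conjugation (mat_unit 1 2 - mat_unit 2 1) X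
    + conjugation (mat_unit 1 3 - mat_unit 3 1) X
    + conjugation (mat_unit 2 3 - mat_unit 3 2) X"
  by (simp add: vec_eq_iff forall_3 conjugation_nth mat_unit_nth sum_3 trace_def mat_def
      transpose_def)

lemma completely_copositive_reduction:
  assumes "0 \<le> c"
  shows "completely_copositive (\<lambda>X. cscale (of_real c) (cscale (trace X) (mat 1) - X))"
proof -
  \<comment> \<open>This map is the witness: precomposing it with transposition keeps the trace and
    turns the transpose back into \<open>X\<close>.\<close>
  have "completely_positive (\<lambda>X. cscale (of_real c) (cscale (trace X) (mat 1) - transpose X))"
    unfolding trace_minus_transpose_eq
    by (intro completely_positive_scale completely_positive_add completely_positive_conjugation
        assms)
  moreover have "trace (transpose X) = trace X" for X :: mat3
    by (simp add: trace_def transpose_def)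
  ultimately show ?thesis
    unfolding completely_copositive_def by (intro exI conjI) (auto simp: fun_eq_iff)
qed

lemma decomposable_Phi2:
  assumes "0 \<le> \<alpha>" "\<alpha> \<le> 1 / 4"
  shows "decomposable (Phi2 \<alpha>)"
  unfolding decomposable_def
proof (intro exI conjI)
  \<comment> \<open>The two bounds on \<open>\<alpha>\<close> are the nonnegativity of the
    coefficients \<open>1 - 4 * \<alpha>\<close> and \<open>2 * \<alpha>\<close>.\<close>
  show "completely_positive (\<lambda>X. cscale (of_real (1 - 4 * \<alpha>)) X)"
    using assms by (intro completely_positive_scale completely_positive_id) simp
  show "completely_copositive (\<lambda>X. cscale (of_real (2 * \<alpha>)) (cscale (trace X) (mat 1) - X))"
    using assms by (intro completely_copositive_reduction) simp
  show "Phi2 \<alpha> = (\<lambda>X. cscale (of_real (1 - 4 * \<alpha>)) X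
      + cscale (of_real (2 * \<alpha>)) (cscale (trace X) (mat 1) - X))"
    by (simp add: fun_eq_iff Phi2_eq vec_eq_iff algebra_simps)
qed

lemma not_completely_positive_Phi2:
  assumes "3 / 16 < \<alpha>"
  shows "\<not> completely_positive (Phi2 \<alpha>)"
proof
  assume cp: "completely_positive (Phi2 \<alpha>)"
  \<comment> \<open>The unnormalized maximally entangled vector; \<open>of_nat\<close> maps 0, 1, 2
    bijectively onto type \<open>3\<close>, where 0 = 3.\<close>
  define e :: "nat \<times> 3 \<Rightarrow> complex" where "e = (\<lambda>(i, a). if a = of_nat i then 1 else 0)"
  define I :: "(nat \<times> 3) set" where "I = {..<3} \<times> UNIV"
  have "psd_on I (\<lambda>p q. e p * e q)"
    unfolding psd_on_def
  proof
    fix v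
    define s where "s = (\<Sum>p\<in>I. e p * v p)"
    have cnj_e: "cnj (e p) = e p" for p
      by (cases p) (simp add: e_def)
    \<comment> \<open>The matrix has rank one and \<open>e\<close> is real, so its form is a squared
      modulus.\<close>
    have "(\<Sum>p\<in>I. \<Sum>q\<in>I. cnj (v p) * (e p * e q) * v q) = cnj s * s"
      by (subst sum.swap) (simp add: s_def cnj_e sum_product mult_ac)
    also have "\<dots> = of_real ((cmod s)\<^sup>2)"
      by (simp only: complex_norm_square mult.commute)
    finally show "(\<Sum>p\<in>I. \<Sum>q\<in>I. cnj (v p) * (e p * e q) * v q) \<in> \<real>\<^sub>\<ge>\<^sub>0"
      by simp
  qed
  with cp have "psd_on I (amplification (Phi2 \<alpha>) (\<lambda>p q. e p * e q))"
    unfolding completely_positive_def I_def by blast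
  then have "(\<Sum>p\<in>I. \<Sum>q\<in>I. cnj (e p) * amplification (Phi2 \<alpha>) (\<lambda>p q. e p * e q) p q * e q) \<in> \<real>\<^sub>\<ge>\<^sub>0"
    unfolding psd_on_def by (rule spec)
  \<comment> \<open>The amplified matrix is the Choi matrix, and its form at \<open>e\<close> adds
    up the (i, j) entries of the images of E_ij: nine terms 1 - 6\<alpha>, and 2\<alpha> from each
    of the three diagonal units. The zero of the total is 3/16.\<close>
  also have "(\<Sum>p\<in>I. \<Sum>q\<in>I. cnj (e p) * amplification (Phi2 \<alpha>) (\<lambda>p q. e p * e q) p q * e q)
      = of_real (9 - 48 * \<alpha>)"
    by (simp add: I_def sum.cartesian_product' amplification_def Phi2_eq e_def
        sum_3 trace_def mat_def lessThan_nat_numeral lessThan_Suc numeral_3_eq_3)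
  finally show False
    using assms by (simp only: nonneg_Reals_of_real_iff)
qed

theorem mainTheorem6:
  shows "(\<forall>\<alpha>. complex_linear (Phi2 \<alpha>)) \<and>
    (\<forall>\<rho> :: complex^3^3. Phi2 (1 / 4) \<rho> = vector
      [vector [(\<rho> $ 2 $ 2 + \<rho> $ 3 $ 3) / 2, - (\<rho> $ 1 $ 2) / 2, - (\<rho> $ 1 $ 3) / 2],
       vector [- (\<rho> $ 2 $ 1) / 2, (\<rho> $ 1 $ 1 + \<rho> $ 3 $ 3) / 2, - (\<rho> $ 2 $ 3) / 2],
       vector [- (\<rho> $ 3 $ 1) / 2, - (\<rho> $ 3 $ 2) / 2, (\<rho> $ 1 $ 1 + \<rho> $ 2 $ 2) / 2]]) \<and>
    (\<forall>\<alpha>. 0 \<le> \<alpha> \<and> \<alpha> \<le> 1 / 4 \<longrightarrow> positive_map (Phi2 \<alpha>)) \<and>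
    (\<forall>\<alpha>. 3 / 16 < \<alpha> \<longrightarrow> \<not> completely_positive (Phi2 \<alpha>)) \<and>
    (\<forall>\<alpha>. 3 / 16 < \<alpha> \<and> \<alpha> \<le> 1 / 4 \<longrightarrow>
       positive_map (Phi2 \<alpha>) \<and> \<not> completely_positive (Phi2 \<alpha>)) \<and>
    (\<forall>\<alpha>. 0 \<le> \<alpha> \<and> \<alpha> \<le> 1 / 4 \<longrightarrow> decomposable (Phi2 \<alpha>))"
  \<comment> \<open>Positivity is read off from the decomposition.\<close>
  using decomposable_imp_positive[OF decomposable_Phi2]
  by (simp add: complex_linear_Phi2 Phi2_quarter not_completely_positive_Phi2 decomposable_Phi2)

end
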